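(* For every $x \in (0,\pi)$, we have $$\frac{\sin x}{x} \;\geq\; \left(1 - \frac{x^2}{\pi^2}\right)^{\frac{\pi^4}{90}} e^{x^2\left(\frac{\pi^2}{90}-\frac{1}{6}\right)} \;\geq\; \left(1 - \frac{x^2}{\pi^2}\right)^{\frac{\pi^2}{6}}.$$
   Context: All powers are real powers of positive real numbers. *)

theory Defs
  imports Complex_Main
begin

end

theory Submission
  imports Defs "HOL-Analysis.Gamma_Function" "HOL-Real_Asymp.Real_Asymp"
begin

text \<open>
  Put \<open>t = x\<^sup>2 / pi\<^sup>2\<close>. Euler's product for the sine gives
  \<open>ln (sin x / x) = (\<Sum>n\<ge>1. ln (1 - t / n\<^sup>2))\<close>. Separating the linear part of every
  logarithm, with \<open>R u = - ln (1 - u) - u = u\<^sup>2/2 + u\<^sup>3/3 + \<dots>\<close>, turns this into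
  \<open>- ln (sin x / x) = \<zeta>(2) t + (\<Sum>n\<ge>1. R (t / n\<^sup>2))\<close>.
  Since \<open>\<zeta>(2) = pi\<^sup>2/6\<close> and \<open>\<zeta>(4) = pi\<^sup>4/90\<close>, minus the logarithm of the middle term of the
  theorem is \<open>\<zeta>(2) t + \<zeta>(4) R t\<close>, and that of the right-hand term is
  \<open>\<zeta>(2) t + \<zeta>(2) R t\<close>.

  The power series of \<open>R\<close> starts in degree two and has nonnegative coefficients, so
  \<open>R (a t) \<le> a\<^sup>2 R t\<close> for \<open>0 \<le> a \<le> 1\<close> (lemma \<open>ln_remainder_scale\<close>). Taking \<open>a = 1 / n\<^sup>2\<close> and
  summing gives the first inequality; the second one is \<open>\<zeta>(4) \<le> \<zeta>(2)\<close> together with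
  \<open>R t \<ge> 0\<close>.

  The same estimate yields the value of \<open>\<zeta>(4)\<close>: combined with \<open>u\<^sup>2/2 \<le> R u\<close>, it encloses
  \<open>- ln (sin x / x) - x\<^sup>2/6\<close> between \<open>\<zeta>(4) t\<^sup>2/2\<close> and \<open>\<zeta>(4) R t\<close>, whereas its Taylor
  expansion at \<open>0\<close> starts with \<open>x\<^sup>4/180\<close>.
\<close>

section \<open>The second-order remainder of the logarithm\<close>

definition ln_remainder :: "real \<Rightarrow> real" where
  "ln_remainder u = - ln (1 - u) - u"

lemma ln_remainder_0 [simp]: "ln_remainder 0 = 0"
  by (simp add: ln_remainder_def)

lemma has_real_derivative_ln_remainder:
  assumes "u < 1"
  shows "(ln_remainder has_real_derivative u / (1 - u)) (at u)"
  unfolding ln_remainder_def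
  by (rule derivative_eq_intros refl | use assms in \<open>simp add: field_simps\<close>)+

lemma ln_remainder_lower_bound:
  assumes "0 \<le> u" "u < 1"
  shows "u\<^sup>2 / 2 \<le> ln_remainder u"
proof -
  define g where "g v = ln_remainder v - v\<^sup>2 / 2" for v
  have "g 0 \<le> g u"
  proof (rule DERIV_nonneg_imp_nondecreasing[OF assms(1)])
    fix v assume v: "0 \<le> v" "v \<le> u"
    have "(g has_real_derivative v / (1 - v) - v) (at v)"
      unfolding g_def using v assms
      by (auto intro!: derivative_eq_intros has_real_derivative_ln_remainder)
    moreover have "v \<le> v / (1 - v)"
      using v assms by (simp add: field_simps)
    ultimately show "\<exists>y. (g has_real_derivative y) (at v) \<and> y \<ge> 0"
      by (intro exI[of _ "v / (1 - v) - v"]) simp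
  qed
  thus ?thesis by (simp add: g_def)
qed

text \<open>
  In other words, \<open>ln_remainder u / u\<^sup>2\<close> is increasing. Differentiating both sides in \<open>t\<close>
  reduces the inequality to \<open>a\<^sup>2 t / (1 - a t) \<le> a\<^sup>2 t / (1 - t)\<close>.
\<close>

lemma ln_remainder_scale:
  assumes "0 \<le> a" "a \<le> 1" "0 \<le> t" "t < 1"
  shows "ln_remainder (a * t) \<le> a\<^sup>2 * ln_remainder t"
proof -
  define g where "g s = a\<^sup>2 * ln_remainder s - ln_remainder (a * s)" for s
  have "g 0 \<le> g t"
  proof (rule DERIV_nonneg_imp_nondecreasing[OF assms(3)])
    fix s assume s: "0 \<le> s" "s \<le> t"
    have as: "a * s \<le> s" using s assms by (simp add: mult_left_le_one_le)
    have "((\<lambda>s. ln_remainder (a * s)) has_real_derivative (a * s) / (1 - a * s) * a) (at s)"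
      using s assms as
      by (intro DERIV_chain2[where f = ln_remainder] has_real_derivative_ln_remainder)
         (auto intro!: derivative_eq_intros)
    hence "(g has_real_derivative a\<^sup>2 * (s / (1 - s)) - (a * s) / (1 - a * s) * a) (at s)"
      unfolding g_def using s assms
      by (auto intro!: derivative_eq_intros has_real_derivative_ln_remainder)
    moreover have "(a\<^sup>2 * s) / (1 - a * s) \<le> (a\<^sup>2 * s) / (1 - s)"
      using s assms as by (intro divide_left_mono) auto
    ultimately show "\<exists>y. (g has_real_derivative y) (at s) \<and> y \<ge> 0"
      by (intro exI[of _ "a\<^sup>2 * (s / (1 - s)) - (a * s) / (1 - a * s) * a"])
         (simp add: power2_eq_square mult_ac)
  qed
  thus ?thesis by (simp add: g_def)
qed

section \<open>Euler's product and the value of zeta at 4\<close>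

lemma sum_ln_remainder_sin:
  assumes "0 < x" "x < pi"
  shows "(\<lambda>n. ln_remainder (1 / (real n + 1)\<^sup>2 * (x\<^sup>2 / pi\<^sup>2)))
           sums (- ln (sin x / x) - x\<^sup>2 / 6)"
proof -
  define t where "t = x\<^sup>2 / pi\<^sup>2"
  have t: "t < 1"
    unfolding t_def using assms by (simp add: power_strict_mono)
  have factor_pos: "0 < 1 - t / (real n)\<^sup>2" if "n \<ge> 1" for n
  proof -
    have "1 \<le> (real n)\<^sup>2" using that by simp
    moreover from this t have "t < (real n)\<^sup>2" by linarith
    ultimately have "t / (real n)\<^sup>2 < 1" by (subst divide_less_eq_1_pos) linarith+
    thus ?thesis by simp
  qed
  have "(\<lambda>n. \<Prod>k=1..n. 1 - t / (real k)\<^sup>2) \<longlonglongrightarrow> sin x / x"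
    using sin_product_formula_real'[of "x / pi"] assms by (simp add: t_def power_divide)
  moreover have "sin x / x \<noteq> 0"
    using assms sin_gt_zero[of x] by simp
  ultimately have "(\<lambda>n. ln (\<Prod>k=1..n. 1 - t / (real k)\<^sup>2)) \<longlonglongrightarrow> ln (sin x / x)"
    by (intro tendsto_ln)
  also have "(\<lambda>n. ln (\<Prod>k=1..n. 1 - t / (real k)\<^sup>2)) =
               (\<lambda>n. \<Sum>k<n. ln (1 - t / (real k + 1)\<^sup>2))"
  proof
    fix n
    have "ln (\<Prod>k=1..n. 1 - t / (real k)\<^sup>2) = (\<Sum>k=1..n. ln (1 - t / (real k)\<^sup>2))"
      by (rule ln_prod) (use factor_pos in \<open>force+\<close>)
    also have "\<dots> = (\<Sum>k<n. ln (1 - t / (real k + 1)\<^sup>2))"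
      by (rule sum.reindex_bij_witness[of _ Suc "\<lambda>k. k - 1"]) (auto simp: add_ac)
    finally show "ln (\<Prod>k=1..n. 1 - t / (real k)\<^sup>2) = \<dots>" .
  qed
  finally have "(\<lambda>n. ln (1 - t / (real n + 1)\<^sup>2)) sums ln (sin x / x)"
    by (simp add: sums_def)
  moreover have "(\<lambda>n. t * (1 / (real n + 1)\<^sup>2)) sums (t * (pi\<^sup>2 / 6))"
    using sums_mult[OF inverse_squares_sums, of t] by (simp add: add_ac)
  ultimately have "(\<lambda>n. - ln (1 - t / (real n + 1)\<^sup>2) - t * (1 / (real n + 1)\<^sup>2))
                     sums (- ln (sin x / x) - t * (pi\<^sup>2 / 6))"
    by (intro sums_diff sums_minus)
  thus ?thesis by (simp add: ln_remainder_def t_def mult.commute)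
qed

lemma summable_inverse_fourth_powers: "summable (\<lambda>n. (1 / (real n + 1)\<^sup>2)\<^sup>2)"
  and suminf_inverse_fourth_powers_le: "(\<Sum>n. (1 / (real n + 1)\<^sup>2)\<^sup>2) \<le> pi\<^sup>2 / 6"
proof -
  have squares: "(\<lambda>n. 1 / (real n + 1)\<^sup>2) sums (pi\<^sup>2 / 6)"
    using inverse_squares_sums by (simp add: add_ac)
  have le: "(1 / (real n + 1)\<^sup>2)\<^sup>2 \<le> 1 / (real n + 1)\<^sup>2" for n
    unfolding power2_eq_square[of "1 / (real n + 1)\<^sup>2"] by (rule mult_left_le) auto
  show summable: "summable (\<lambda>n. (1 / (real n + 1)\<^sup>2)\<^sup>2)"
    by (rule summable_comparison_test'[OF sums_summable[OF squares], of 0]) (use le in auto)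
  show "(\<Sum>n. (1 / (real n + 1)\<^sup>2)\<^sup>2) \<le> pi\<^sup>2 / 6"
    by (rule sums_le[OF le summable_sums[OF summable] squares])
qed

text \<open>
  Both bounds compare the series termwise with that of the fourth powers. The upper one is the
  first inequality of the theorem in logarithmic form; as the two agree to leading order at
  \<open>0\<close>, they also determine the sum of the inverse fourth powers.
\<close>

lemma ln_sin_bounds:
  fixes x :: real
  defines "Z \<equiv> (\<Sum>n. (1 / (real n + 1)\<^sup>2)\<^sup>2)"
  assumes "0 < x" "x < pi"
  shows "Z * ((x\<^sup>2 / pi\<^sup>2)\<^sup>2 / 2) \<le> - ln (sin x / x) - x\<^sup>2 / 6"
    and "- ln (sin x / x) - x\<^sup>2 / 6 \<le> Z * ln_remainder (x\<^sup>2 / pi\<^sup>2)"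
proof -
  define t where "t = x\<^sup>2 / pi\<^sup>2"
  have t: "0 \<le> t" "t < 1"
    unfolding t_def using assms by (simp_all add: power_strict_mono)
  have a: "0 \<le> 1 / (real n + 1)\<^sup>2" "1 / (real n + 1)\<^sup>2 \<le> 1" for n
    by auto
  have fourth: "(\<lambda>n. (1 / (real n + 1)\<^sup>2)\<^sup>2) sums Z"
    unfolding Z_def by (rule summable_sums[OF summable_inverse_fourth_powers])
  have series: "(\<lambda>n. ln_remainder (1 / (real n + 1)\<^sup>2 * t)) sums (- ln (sin x / x) - x\<^sup>2 / 6)"
    unfolding t_def by (rule sum_ln_remainder_sin) fact+
  show "- ln (sin x / x) - x\<^sup>2 / 6 \<le> Z * ln_remainder (x\<^sup>2 / pi\<^sup>2)"
    unfolding t_def[symmetric]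
    by (rule sums_le[OF ln_remainder_scale[OF a t] series sums_mult2[OF fourth]])
  have "(1 / (real n + 1)\<^sup>2)\<^sup>2 * (t\<^sup>2 / 2) \<le> ln_remainder (1 / (real n + 1)\<^sup>2 * t)" for n
  proof -
    have "1 / (real n + 1)\<^sup>2 * t \<le> t"
      by (rule mult_left_le_one_le) (use a t in auto)
    hence "(1 / (real n + 1)\<^sup>2 * t)\<^sup>2 / 2 \<le> ln_remainder (1 / (real n + 1)\<^sup>2 * t)"
      using a[of n] t
      by (intro ln_remainder_lower_bound mult_nonneg_nonneg) linarith+
    thus ?thesis unfolding power_mult_distrib by simp
  qed
  from sums_le[OF this sums_mult2[OF fourth] series]
  show "Z * ((x\<^sup>2 / pi\<^sup>2)\<^sup>2 / 2) \<le> - ln (sin x / x) - x\<^sup>2 / 6"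
    unfolding t_def .
qed

theorem suminf_inverse_fourth_powers: "(\<Sum>n. (1 / (real n + 1)\<^sup>2)\<^sup>2) = pi ^ 4 / 90"
proof -
  define Z where "Z = (\<Sum>n. (1 / (real n + 1)\<^sup>2)\<^sup>2)"
  define L where "L = (\<lambda>x::real. (- ln (sin x / x) - x\<^sup>2 / 6) / x ^ 4)"
  define U where "U = (\<lambda>x. Z / pi ^ 4 * (ln_remainder (x\<^sup>2 / pi\<^sup>2) / (x\<^sup>2 / pi\<^sup>2)\<^sup>2))"
  have lim_L: "(L \<longlongrightarrow> 1 / 180) (at_right 0)"
    unfolding L_def by real_asymp
  have "((\<lambda>u. ln_remainder u / u\<^sup>2) \<longlongrightarrow> 1 / 2) (at_right 0)"
    unfolding ln_remainder_def by real_asymp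
  moreover have "filterlim (\<lambda>x::real. x\<^sup>2 / pi\<^sup>2) (at_right 0) (at_right 0)"
    by real_asymp
  ultimately have "((\<lambda>x. ln_remainder (x\<^sup>2 / pi\<^sup>2) / (x\<^sup>2 / pi\<^sup>2)\<^sup>2) \<longlongrightarrow> 1 / 2) (at_right 0)"
    by (rule filterlim_compose)
  hence "(U \<longlongrightarrow> Z / pi ^ 4 * (1 / 2)) (at_right 0)"
    unfolding U_def by (intro tendsto_mult tendsto_const)
  moreover have "\<forall>\<^sub>F x in at_right 0. Z / pi ^ 4 * (1 / 2) \<le> L x \<and> L x \<le> U x"
  proof -
    have "\<forall>\<^sub>F x in at_right 0. x \<in> {0<..<pi}"
      by (rule eventually_at_right_real) simp
    thus ?thesis
    proof eventually_elim
      case (elim x)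
      have "Z * ((x\<^sup>2 / pi\<^sup>2)\<^sup>2 / 2) / x ^ 4 \<le> L x"
        unfolding L_def Z_def
        by (rule divide_right_mono[OF ln_sin_bounds(1)]) (use elim in auto)
      moreover have "L x \<le> Z * ln_remainder (x\<^sup>2 / pi\<^sup>2) / x ^ 4"
        unfolding L_def Z_def
        by (rule divide_right_mono[OF ln_sin_bounds(2)]) (use elim in auto)
      moreover have "Z * ((x\<^sup>2 / pi\<^sup>2)\<^sup>2 / 2) / x ^ 4 = Z / pi ^ 4 * (1 / 2)"
        using elim by (simp add: field_simps flip: power_mult)
      moreover have "Z * ln_remainder (x\<^sup>2 / pi\<^sup>2) / x ^ 4 = U x"
        using elim unfolding U_def by (simp add: power_divide flip: power_mult)
      ultimately show ?case by simp
    qed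
  qed
  ultimately have "(L \<longlongrightarrow> Z / pi ^ 4 * (1 / 2)) (at_right 0)"
    by (intro tendsto_sandwich[OF _ _ tendsto_const, of _ L _ U])
       (auto elim: eventually_mono)
  from tendsto_unique[OF trivial_limit_at_right_real this lim_L] have limits: "Z / pi ^ 4 * (1 / 2) = 1 / 180" .
  have "Z = 2 * pi ^ 4 * (Z / pi ^ 4 * (1 / 2))" by simp
  also have "\<dots> = pi ^ 4 / 90" unfolding limits by simp
  finally show ?thesis unfolding Z_def .
qed

section \<open>The two inequalities\<close>

theorem mainTheorem4:
  fixes x :: real
  assumes "0 < x" and "x < pi"
  shows "sin x / x \<ge> (1 - x\<^sup>2 / pi\<^sup>2) powr (pi ^ 4 / 90) * exp (x\<^sup>2 * (pi\<^sup>2 / 90 - 1 / 6))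
    \<and> (1 - x\<^sup>2 / pi\<^sup>2) powr (pi ^ 4 / 90) * exp (x\<^sup>2 * (pi\<^sup>2 / 90 - 1 / 6))
        \<ge> (1 - x\<^sup>2 / pi\<^sup>2) powr (pi\<^sup>2 / 6)"
proof -
  define t where "t = x\<^sup>2 / pi\<^sup>2"
  have t: "0 \<le> t" "t < 1"
    unfolding t_def using assms by (simp_all add: power_strict_mono)
  have x2: "x\<^sup>2 = pi\<^sup>2 * t" by (simp add: t_def)
  have ln_1_minus: "ln (1 - t) = - ln_remainder t - t"
    by (simp add: ln_remainder_def)
  have "0 \<le> ln_remainder t"
    by (rule order_trans[OF _ ln_remainder_lower_bound]) (use t in auto)
  hence zeta: "pi ^ 4 / 90 * ln_remainder t \<le> pi\<^sup>2 / 6 * ln_remainder t"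
    using suminf_inverse_fourth_powers_le unfolding suminf_inverse_fourth_powers
    by (intro mult_right_mono)
  have middle: "(1 - t) powr (pi ^ 4 / 90) * exp (x\<^sup>2 * (pi\<^sup>2 / 90 - 1 / 6)) =
                  exp (- (pi\<^sup>2 / 6 * t) - pi ^ 4 / 90 * ln_remainder t)"
    using t unfolding powr_def ln_1_minus x2
    by (simp add: field_simps power4_eq_xxxx power2_eq_square flip: exp_add)
  have right: "(1 - t) powr (pi\<^sup>2 / 6) = exp (- (pi\<^sup>2 / 6 * t) - pi\<^sup>2 / 6 * ln_remainder t)"
    using t unfolding powr_def ln_1_minus by (simp add: field_simps)
  have "- (pi\<^sup>2 / 6 * t) - pi ^ 4 / 90 * ln_remainder t \<le> ln (sin x / x)"
    using ln_sin_bounds(2)[OF assms] unfolding suminf_inverse_fourth_powers t_def[symmetric]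
    unfolding x2 by linarith
  moreover have "0 < sin x / x"
    using assms sin_gt_zero[of x] by simp
  ultimately have "exp (- (pi\<^sup>2 / 6 * t) - pi ^ 4 / 90 * ln_remainder t) \<le> sin x / x"
    by (simp add: ln_ge_iff)
  thus ?thesis
    unfolding t_def[symmetric] middle right using zeta by simp
qed

end
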